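(* For $n\to\infty$, unit balls can cover the entire Euclidean space $\mathbb R^n$ with density $$\vartheta(\mathbb R^n)\le\left(\frac12+o(1)\right)n\ln n ,$$ i.e. there is a sequence $\eta_n\to 0$ such that $\vartheta(\mathbb R^n)\le(\tfrac12+\eta_n)\,n\ln n$ for all sufficiently large $n$.
   Context: $B_R^n(\mathbf x)$ is the closed Euclidean ball of radius $R$ in $\mathbb R^n$ centered at $\mathbf x$, and $|\cdot|$ is Lebesgue measure. A unit covering of $\mathbb R^n$ is a set $X\subset\mathbb R^n$ with $\mathbb R^n=\bigcup_{\mathbf x\in X}B_1^n(\mathbf x)$. Its density is $\limsup_{R\to\infty}\sum_{\mathbf x\in X}|B_1^n(\mathbf x)\cap B_R^n(\mathbf 0)|/|B_R^n(\mathbf 0)|$, and $\vartheta(\mathbb R^n)$ is the minimum (infimum) covering density, i.e. the infimum of these densities over all unit coverings $X$ of $\mathbb R^n$. *)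

theory Defs
  imports "HOL-Analysis.Analysis"
begin

text \<open>
  The dimension varies in the asymptotic statement, so \<open>\<real>\<^sup>n\<close> is not modelled by a type but by the
  functions on \<open>{..<n}\<close>, extended by \<open>undefined\<close> outside; these are exactly the points of the
  product measure space \<open>\<Pi>\<^sub>M i\<in>{..<n}. lborel\<close>.
\<close>

definition euc :: "nat \<Rightarrow> (nat \<Rightarrow> real) set" where
  "euc n = (\<Pi>\<^sub>E i\<in>{..<n}. UNIV)"

definition euc_zero :: "nat \<Rightarrow> nat \<Rightarrow> real" where
  "euc_zero n = (\<lambda>i\<in>{..<n}. 0)"

text \<open>Lebesgue measure on the Borel sets of \<open>\<real>\<^sup>n\<close>.\<close>

definition euc_lborel :: "nat \<Rightarrow> (nat \<Rightarrow> real) measure" where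
  "euc_lborel n = (\<Pi>\<^sub>M i\<in>{..<n}. lborel)"

definition euc_cball :: "nat \<Rightarrow> real \<Rightarrow> (nat \<Rightarrow> real) \<Rightarrow> (nat \<Rightarrow> real) set" where
  "euc_cball n R x = {y \<in> euc n. L2_set (\<lambda>i. y i - x i) {..<n} \<le> R}"

definition unit_covering :: "nat \<Rightarrow> (nat \<Rightarrow> real) set \<Rightarrow> bool" where
  "unit_covering n X \<longleftrightarrow> X \<subseteq> euc n \<and> euc n = (\<Union>x\<in>X. euc_cball n 1 x)"

text \<open>
  The sum is over an arbitrary, possibly uncountable, set \<open>X\<close>. In \<^typ>\<open>ennreal\<close> it always exists,
  as the supremum of the finite partial sums, and densities may be infinite.
\<close>

definition covering_density :: "nat \<Rightarrow> (nat \<Rightarrow> real) set \<Rightarrow> ennreal" where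
  "covering_density n X =
     Limsup at_top (\<lambda>R::real.
       (\<Sum>\<^sub>\<infinity>x\<in>X. emeasure (euc_lborel n) (euc_cball n 1 x \<inter> euc_cball n R (euc_zero n)))
         / emeasure (euc_lborel n) (euc_cball n R (euc_zero n)))"

definition min_covering_density :: "nat \<Rightarrow> ennreal" where
  "min_covering_density n = (INF X\<in>{X. unit_covering n X}. covering_density n X)"

lemma space_euc_lborel: "space (euc_lborel n) = euc n"
  by (simp add: euc_lborel_def euc_def space_PiM)

text \<open>
  \<^const>\<open>emeasure\<close> is \<open>0\<close> on non-measurable sets; the following shows that this default value is
  never used in the definition of the density.
\<close>

lemma euc_cball_measurable: "euc_cball n R x \<in> sets (euc_lborel n)"
proof -
  have "(\<lambda>y. L2_set (\<lambda>i. y i - x i) {..<n}) \<in> borel_measurable (euc_lborel n)"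
    unfolding L2_set_def euc_lborel_def by measurable
  then have "{y \<in> space (euc_lborel n). L2_set (\<lambda>i. y i - x i) {..<n} \<le> R} \<in> sets (euc_lborel n)"
    by measurable
  then show ?thesis
    by (simp add: euc_cball_def space_euc_lborel)
qed

end

theory Submission
  imports Defs "HOL-Probability.Distributions" "HOL-Real_Asymp.Real_Asymp"
begin

text \<open>
  A random set of unit balls of density \<open>D\<close> leaves a proportion of about \<open>e\<^sup>-\<^sup>D\<close> of space uncovered. The
  classical argument patches the holes by one ball for each uncovered point of a grid of mesh
  \<open>\<epsilon> \<approx> 1/n\<close>; there are about \<open>\<epsilon>\<^sup>-\<^sup>n = e\<^bsup>n ln n\<^esup>\<close> such points per unit ball, which forces
  \<open>D \<approx> n ln n\<close>. The factor \<open>1/2\<close> is gained by using a second, coarser grid of mesh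
  \<open>\<rho>\<close> smaller than \<open>1/\<surd>n\<close> by a logarithmic factor, which has only \<open>e\<^bsup>(1/2 + o(1)) n ln n\<^esup>\<close> points per unit ball.

  The reason why such a coarse grid suffices is concentration of measure. Let \<open>u\<close> be a coarse grid
  point, \<open>y\<close> a fine one with \<open>|y - u| \<le> \<rho>\<close>, and let \<open>z\<close> be uniform in the ball of radius
  \<open>1 - s\<close> about \<open>u\<close>, where \<open>s = o(1/n)\<close>, so that the ball has almost full volume. If \<open>z\<close> misses the
  ball of radius \<open>1 - \<epsilon>\<close> about \<open>y\<close>, then \<open>z\<close> lies in a cap at distance at least \<open>s / (2 \<rho>)\<close> from the centre
  (lemma \<open>cball_diff_cball_subset\<close>), an event of probability at most \<open>\<delta> \<approx> e\<^bsup>- n s\<^sup>2 / (8 \<rho>\<^sup>2)\<^esup>\<close>. With \<open>s\<close> a little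
  below \<open>1/n\<close> and \<open>\<rho>\<close> much further below \<open>1/\<surd>n\<close>, this is smaller than every power of \<open>1/n\<close>.

  Call \<open>u\<close> bad if fewer than \<open>k \<approx> n / ln n\<close> of the random centres fall into its ball, and \<open>y\<close> bad if
  at least \<open>k\<close> of them fall into the cap that belongs to \<open>y\<close>. A coarse point is bad with probability
  \<open>e\<^bsup>- D + o(n ln n)\<^esup>\<close>, because \<open>k\<close> is so small; so \<open>D = (1/2 + o(1)) n ln n\<close> makes the bad coarse
  points negligible. A fine point is bad with probability at most
  \<open>e\<^bsup>O(n ln n)\<^esup> \<delta>\<^sup>k\<close>, and \<open>\<delta>\<^sup>k\<close> outweighs every \<open>e\<^bsup>O(n ln n)\<^esup>\<close>. If neither \<open>u\<close> nor \<open>y\<close> is bad, then one of the centres is within \<open>1 - \<epsilon>\<close> of \<open>y\<close>, and its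
  unit ball contains the \<open>\<epsilon>\<close>-neighbourhood of \<open>y\<close>. Hence the random balls, together with one unit
  ball about each bad point, cover a large cube (\<open>covering_of_cube\<close>), and translating this
  arrangement periodically covers the space (\<open>min_covering_density_le_cube\<close>).

  The existence of good centres is proved by averaging an exponential potential, one centre at a time
  (\<open>exists_list_weighted_counts_le\<close>), which makes binomial tail estimates superfluous.
\<close>

section \<open>Distances and volumes of Euclidean balls\<close>

abbreviation euc_dist :: "nat \<Rightarrow> (nat \<Rightarrow> real) \<Rightarrow> (nat \<Rightarrow> real) \<Rightarrow> real" where
  "euc_dist n x y \<equiv> L2_set (\<lambda>i. x i - y i) {..<n}"

interpretation lborel_product: product_sigma_finite "\<lambda>_. lborel :: real measure"
  by standard

lemma euc_dist_commute: "euc_dist n x y = euc_dist n y x"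
  by (simp add: L2_set_def power2_commute)

lemma euc_dist_triangle: "euc_dist n x z \<le> euc_dist n x y + euc_dist n y z"
  using L2_set_triangle_ineq[of "\<lambda>i. x i - y i" "\<lambda>i. y i - z i" "{..<n}"] by simp

lemma euc_dist_le_sqrt:
  assumes "\<And>i. i < n \<Longrightarrow> \<bar>x i - y i\<bar> \<le> h" "0 \<le> h"
  shows "euc_dist n x y \<le> sqrt (real n) * h"
proof -
  have "(\<Sum>i<n. (x i - y i)\<^sup>2) \<le> (\<Sum>i<n. h\<^sup>2)"
    using assms by (intro sum_mono) (auto intro: abs_le_square_iff[THEN iffD1])
  then have "euc_dist n x y \<le> sqrt (real n * h\<^sup>2)"
    unfolding L2_set_def by (intro real_sqrt_le_mono) simp
  also have "\<dots> = sqrt (real n) * h"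
    using assms(2) by (simp add: real_sqrt_mult)
  finally show ?thesis .
qed

lemma sets_euc_box:
  "(\<And>i. i < n \<Longrightarrow> A i \<in> sets borel) \<Longrightarrow> Pi\<^sub>E {..<n} A \<in> sets (euc_lborel n)"
  unfolding euc_lborel_def by (intro sets_PiM_I_finite) auto

lemma emeasure_euc_box:
  "(\<And>i. i < n \<Longrightarrow> A i \<in> sets borel) \<Longrightarrow>
    emeasure (euc_lborel n) (Pi\<^sub>E {..<n} A) = (\<Prod>i<n. emeasure lborel (A i))"
  unfolding euc_lborel_def by (intro lborel_product.emeasure_PiM) auto

text \<open>
  Both sides are product measures, so it suffices to compare them on boxes, where the claim factors
  into the one-dimensional one.
\<close>

lemma euc_lborel_affine:
  assumes "r > 0"
  shows "density (distr (euc_lborel n) (euc_lborel n) (\<lambda>x. \<lambda>i\<in>{..<n}. c i + r * x i)) (\<lambda>_. ennreal (r ^ n))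
    = euc_lborel n" (is "density (distr _ _ ?T) _ = _")
  unfolding euc_lborel_def
proof (rule lborel_product.PiM_eqI)
  let ?M = "\<Pi>\<^sub>M i\<in>{..<n}. (lborel :: real measure)"
  have T[measurable]: "?T \<in> measurable ?M ?M" by measurable
  show "sets (density (distr ?M ?M ?T) (\<lambda>_. ennreal (r ^ n))) = sets ?M" by simp
  fix A :: "nat \<Rightarrow> real set" assume A: "\<And>i. i \<in> {..<n} \<Longrightarrow> A i \<in> sets lborel"
  have A'[measurable]: "Pi\<^sub>E {..<n} A \<in> sets ?M" using A by (intro sets_PiM_I_finite) auto
  have "?T -` Pi\<^sub>E {..<n} A \<inter> space ?M = (\<Pi>\<^sub>E i\<in>{..<n}. (\<lambda>x. c i + r * x) -` A i)"
    by (auto simp: space_PiM PiE_iff)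
  moreover have "emeasure ?M (\<Pi>\<^sub>E i\<in>{..<n}. (\<lambda>x. c i + r * x) -` A i)
      = (\<Prod>i<n. emeasure lborel ((\<lambda>x. c i + r * x) -` A i))"
    using A by (intro lborel_product.emeasure_PiM) (auto intro!: measurable_sets_borel[where M=borel])
  moreover have "ennreal r * emeasure lborel ((\<lambda>x. c i + r * x) -` A i) = emeasure lborel (A i)" if "i < n" for i
  proof -
    have "emeasure lborel (A i) = emeasure (density (distr lborel borel (\<lambda>x. c i + r * x)) (\<lambda>_. ennreal (abs r))) (A i)"
      using assms by (subst lborel_real_affine[of r "c i", symmetric]) auto
    also have "\<dots> = ennreal r * emeasure lborel ((\<lambda>x. c i + r * x) -` A i)"
      using assms A that by (subst emeasure_density_const) (auto simp: emeasure_distr)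
    finally show ?thesis by simp
  qed
  ultimately have eq: "emeasure ?M (?T -` Pi\<^sub>E {..<n} A \<inter> space ?M)
      = (\<Prod>i<n. emeasure lborel ((\<lambda>x. c i + r * x) -` A i))"
    and fac: "\<And>i. i < n \<Longrightarrow> ennreal r * emeasure lborel ((\<lambda>x. c i + r * x) -` A i) = emeasure lborel (A i)"
    by simp_all
  have "emeasure (density (distr ?M ?M ?T) (\<lambda>_. ennreal (r ^ n))) (Pi\<^sub>E {..<n} A)
      = ennreal (r ^ n) * emeasure ?M (?T -` Pi\<^sub>E {..<n} A \<inter> space ?M)"
    by (subst emeasure_density_const) (simp_all add: emeasure_distr)
  also have "\<dots> = (\<Prod>i<n. ennreal r) * (\<Prod>i<n. emeasure lborel ((\<lambda>x. c i + r * x) -` A i))"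
    using assms by (simp only: eq prod_constant card_lessThan ennreal_power less_imp_le)
  also have "\<dots> = (\<Prod>i<n. ennreal r * emeasure lborel ((\<lambda>x. c i + r * x) -` A i))"
    by (rule prod.distrib[symmetric])
  also have "\<dots> = (\<Prod>i<n. emeasure lborel (A i))"
    by (rule prod.cong) (auto intro: fac)
  finally show "emeasure (density (distr ?M ?M ?T) (\<lambda>_. ennreal (r ^ n))) (Pi\<^sub>E {..<n} A)
      = (\<Prod>i\<in>{..<n}. emeasure lborel (A i))" .
qed simp

lemma emeasure_euc_cball_scale:
  assumes "r > 0"
  shows "emeasure (euc_lborel n) (euc_cball n r c)
    = ennreal (r ^ n) * emeasure (euc_lborel n) (euc_cball n 1 (euc_zero n))"
proof -
  let ?T = "\<lambda>x. \<lambda>i\<in>{..<n}. c i + r * x i"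
  have T[measurable]: "?T \<in> measurable (euc_lborel n) (euc_lborel n)"
    unfolding euc_lborel_def by measurable
  note [measurable] = euc_cball_measurable
  have "emeasure (euc_lborel n) (euc_cball n r c) = ennreal (r ^ n) *
      emeasure (euc_lborel n) (?T -` euc_cball n r c \<inter> space (euc_lborel n))"
    by (subst euc_lborel_affine[OF assms, of n c, symmetric])
       (simp add: emeasure_density_const emeasure_distr)
  also have "?T -` euc_cball n r c \<inter> space (euc_lborel n) = euc_cball n 1 (euc_zero n)"
  proof -
    have "L2_set (\<lambda>i. ?T x i - c i) {..<n} = r * euc_dist n x (euc_zero n)" for x
    proof -
      have "L2_set (\<lambda>i. ?T x i - c i) {..<n} = L2_set (\<lambda>i. r * (x i - euc_zero n i)) {..<n}"
        by (rule L2_set_cong) (auto simp: euc_zero_def)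
      also have "\<dots> = r * euc_dist n x (euc_zero n)"
        using assms by (subst L2_set_right_distrib) auto
      finally show ?thesis .
    qed
    moreover have "?T x \<in> euc n" for x by (auto simp: euc_def)
    ultimately show ?thesis
      using assms by (auto simp: euc_cball_def space_euc_lborel)
  qed
  finally show ?thesis .
qed

text \<open>
  On the ball of radius \<open>\<surd>n\<close> the standard Gaussian density is at least its value at the boundary, and
  its total mass is one. The bound is of the order \<open>(2 \<pi> e / n)\<^bsup>n/2\<^esup>\<close>; the factor \<open>n\<^bsup>- n/2\<^esup>\<close> is what
  reduces the number of points of a cubic grid of side \<open>\<rho>/\<surd>n\<close> per unit ball to \<open>O(1/\<rho>)\<^sup>n\<close>.
\<close>

lemma emeasure_unit_ball_le:
  assumes "n > 0"
  shows "emeasure (euc_lborel n) (euc_cball n 1 (euc_zero n)) \<le>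
    ennreal ((sqrt (2 * pi) * exp (1/2) / sqrt (real n)) ^ n)"
proof -
  let ?M = "euc_lborel n" and ?B = "euc_cball n (sqrt (real n)) (euc_zero n)"
  define c where "c = (1 / sqrt (2 * pi)) ^ n * exp (- (real n / 2))"
  have c: "c > 0" by (simp add: c_def)
  have ind: "ennreal c * indicator ?B x \<le> (\<Prod>i<n. ennreal (std_normal_density (x i)))" for x
  proof (cases "x \<in> ?B")
    case True
    have "L2_set x {..<n} = euc_dist n x (euc_zero n)"
      by (rule L2_set_cong) (auto simp: euc_zero_def)
    also have "\<dots> \<le> sqrt (real n)" using True by (simp add: euc_cball_def)
    finally have *: "(\<Sum>i<n. (x i)\<^sup>2) \<le> real n" by (simp add: L2_set_def)
    have "c \<le> (1 / sqrt (2 * pi)) ^ n * exp (- (\<Sum>i<n. (x i)\<^sup>2) / 2)"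
      unfolding c_def using * by (intro mult_left_mono) auto
    also have "\<dots> = (\<Prod>i<n. std_normal_density (x i))"
      by (simp add: std_normal_density_def prod.distrib prod_dividef exp_sum[symmetric]
          sum_divide_distrib[symmetric] sum_negf power_one_over)
    finally have "ennreal c \<le> ennreal (\<Prod>i<n. std_normal_density (x i))"
      by (rule ennreal_leI)
    then show ?thesis using True by (simp add: prod_ennreal)
  qed simp
  have one: "(\<integral>\<^sup>+x. ennreal (std_normal_density x) \<partial>lborel) = 1"
    using prob_space.emeasure_space_1[OF prob_space_normal_density[of 1 0]]
    by (simp add: emeasure_density)
  have "ennreal c * emeasure ?M ?B = (\<integral>\<^sup>+x. ennreal c * indicator ?B x \<partial>?M)"
    by (rule nn_integral_cmult_indicator[symmetric, OF euc_cball_measurable])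
  also have "\<dots> \<le> (\<integral>\<^sup>+x. (\<Prod>i<n. ennreal (std_normal_density (x i))) \<partial>?M)"
    by (intro nn_integral_mono ind)
  also have "\<dots> = 1"
    unfolding euc_lborel_def by (subst lborel_product.product_nn_integral_prod) (auto simp: one)
  finally have "ennreal c * emeasure ?M ?B \<le> 1" .
  define s where "s = sqrt (real n) ^ n"
  define E where "E = emeasure ?M (euc_cball n 1 (euc_zero n))"
  have s: "s > 0" using assms by (simp add: s_def)
  have "emeasure ?M ?B = ennreal s * E"
    unfolding s_def E_def using assms by (intro emeasure_euc_cball_scale) simp
  moreover have "ennreal (c * s) = ennreal c * ennreal s"
    using c s by (intro ennreal_mult) auto
  ultimately have le: "ennreal (c * s) * E \<le> 1"
    using \<open>ennreal c * emeasure ?M ?B \<le> 1\<close> by (simp only: mult.assoc)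
  have cs: "c * s > 0" using c s by simp
  have "exp (- (real n / 2)) = inverse (exp (1/2) ^ n)"
    by (simp add: exp_minus exp_of_nat_mult[symmetric])
  then have inv: "inverse (c * s) = (sqrt (2 * pi) * exp (1/2) / sqrt (real n)) ^ n"
    unfolding c_def s_def by (simp only: power_divide power_mult_distrib power_one inverse_mult_distrib
        inverse_inverse_eq inverse_eq_divide divide_divide_eq_right times_divide_eq_left
        times_divide_eq_right mult_1 mult_1_right div_by_1 mult.commute)
  have "ennreal (inverse (c * s)) * ennreal (c * s) = ennreal (inverse (c * s) * (c * s))"
    using cs by (intro ennreal_mult[symmetric] less_imp_le positive_imp_inverse_positive)
  also have "\<dots> = 1" using cs by (subst left_inverse) auto
  finally have "E = ennreal (inverse (c * s)) * (ennreal (c * s) * E)"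
    by (simp only: mult.assoc[symmetric] mult_1)
  also have "\<dots> \<le> ennreal (inverse (c * s)) * 1"
    by (intro mult_left_mono le) simp
  finally show ?thesis unfolding inv E_def by simp
qed

definition ball_vol :: "nat \<Rightarrow> real" where
  "ball_vol n = measure (euc_lborel n) (euc_cball n 1 (euc_zero n))"

lemma ball_vol_nonneg [simp]: "0 \<le> ball_vol n"
  by (simp add: ball_vol_def)

lemma emeasure_euc_cball:
  assumes "n > 0" "r > 0"
  shows "emeasure (euc_lborel n) (euc_cball n r c) = ennreal (r ^ n * ball_vol n)"
proof -
  have "emeasure (euc_lborel n) (euc_cball n 1 (euc_zero n)) = ennreal (ball_vol n)"
    unfolding ball_vol_def
    by (rule emeasure_eq_ennreal_measure)
       (use emeasure_unit_ball_le[OF assms(1)] in \<open>auto simp: top_unique\<close>)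
  then show ?thesis
    using assms by (simp only: emeasure_euc_cball_scale[OF assms(2)]) (simp add: ennreal_mult)
qed

lemma ball_vol_le:
  assumes "n > 0"
  shows "ball_vol n \<le> (sqrt (2 * pi) * exp (1/2) / sqrt (real n)) ^ n"
proof -
  define b where "b = (sqrt (2 * pi) * exp (1/2) / sqrt (real n)) ^ n"
  have "b \<ge> 0" unfolding b_def by (intro zero_le_power divide_nonneg_nonneg mult_nonneg_nonneg) auto
  moreover have "ennreal (ball_vol n) \<le> ennreal b"
    using emeasure_unit_ball_le[OF assms] emeasure_euc_cball[OF assms zero_less_one, of "euc_zero n"]
    unfolding b_def by (simp only: power_one mult_1)
  ultimately show ?thesis by (simp add: b_def[symmetric] ennreal_le_iff)
qed

lemma ball_vol_pos:
  assumes "n > 0"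
  shows "ball_vol n > 0"
proof -
  have "(\<Pi>\<^sub>E i\<in>{..<n}. {0..1 / real n}) \<subseteq> euc_cball n 1 (euc_zero n)"
  proof
    fix x assume x: "x \<in> (\<Pi>\<^sub>E i\<in>{..<n}. {0..1 / real n})"
    have "euc_dist n x (euc_zero n) \<le> sqrt (real n) * (1 / real n)"
      using x by (intro euc_dist_le_sqrt) (auto simp: euc_zero_def PiE_iff)
    also have "\<dots> \<le> 1"
      using assms by (simp add: field_simps real_le_lsqrt power2_eq_square)
    finally show "x \<in> euc_cball n 1 (euc_zero n)"
      using x by (auto simp: euc_cball_def euc_def PiE_iff)
  qed
  then have "emeasure (euc_lborel n) (\<Pi>\<^sub>E i\<in>{..<n}. {0..1 / real n})
      \<le> emeasure (euc_lborel n) (euc_cball n 1 (euc_zero n))"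
    by (intro emeasure_mono euc_cball_measurable)
  then have "ennreal ((1 / real n) ^ n) \<le> ennreal (ball_vol n)"
    using assms by (simp add: emeasure_euc_box emeasure_euc_cball ennreal_power)
  then have "(1 / real n) ^ n \<le> ball_vol n" by (simp add: ennreal_le_iff)
  moreover have "(1 / real n) ^ n > 0" using assms by simp
  ultimately show ?thesis by linarith
qed

section \<open>Periodic coverings\<close>

definition periodize :: "nat \<Rightarrow> real \<Rightarrow> (nat \<Rightarrow> real) \<Rightarrow> (nat \<Rightarrow> real) set" where
  "periodize n L c = {x \<in> euc n. \<forall>i<n. \<exists>k::int. x i = c i + L * of_int k}"

text \<open>
  The half-open cubes of side \<open>L\<close> attached to the points of a translated lattice are disjoint, and
  those attached to points of a ball of radius \<open>R\<close> lie in the ball of radius \<open>R + \<surd>n L\<close>: compare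
  volumes.
\<close>

lemma card_periodize_in_ball_le:
  assumes n: "n > 0" and L: "L > 0" and R: "R \<ge> 0"
    and F: "finite F" "F \<subseteq> periodize n L c" "\<And>x. x \<in> F \<Longrightarrow> euc_dist n x (euc_zero n) \<le> R"
  shows "real (card F) * L ^ n \<le> (R + sqrt (real n) * L) ^ n * ball_vol n"
proof -
  define Q where "Q x = (\<Pi>\<^sub>E i\<in>{..<n}. {x i..<x i + L})" for x :: "nat \<Rightarrow> real"
  have disj: "disjoint_family_on Q F"
  proof (unfold disjoint_family_on_def, intro ballI impI)
    fix x y assume xy: "x \<in> F" "y \<in> F" "x \<noteq> y"
    then have "x \<in> periodize n L c" "y \<in> periodize n L c" using F by auto
    moreover from this xy(3) obtain i where i: "i < n" "x i \<noteq> y i"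
      unfolding periodize_def euc_def by (metis (no_types, lifting) PiE_ext lessThan_iff mem_Collect_eq)
    ultimately obtain k l :: int where kl: "x i = c i + L * of_int k" "y i = c i + L * of_int l"
      unfolding periodize_def by blast
    with i have "k \<noteq> l" by auto
    then have "k + 1 \<le> l \<or> l + 1 \<le> k" by linarith
    then have "real_of_int k + 1 \<le> of_int l \<or> real_of_int l + 1 \<le> of_int k"
      by (metis of_int_1 of_int_add of_int_le_iff)
    then have "L * (real_of_int k + 1) \<le> L * of_int l \<or> L * (real_of_int l + 1) \<le> L * of_int k"
      using L by auto
    then have sep: "x i + L \<le> y i \<or> y i + L \<le> x i" using kl by (auto simp: algebra_simps)
    show "Q x \<inter> Q y = {}"
    proof (rule ccontr)
      assume "Q x \<inter> Q y \<noteq> {}"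
      then obtain z where "z \<in> Q x" "z \<in> Q y" by auto
      then have "x i \<le> z i" "z i < x i + L" "y i \<le> z i" "z i < y i + L"
        using i(1) by (auto simp: Q_def PiE_iff)
      with sep show False by linarith
    qed
  qed
  have Qm: "Q x \<in> sets (euc_lborel n)" for x
    unfolding Q_def by (rule sets_euc_box) auto
  have Qv: "emeasure (euc_lborel n) (Q x) = ennreal (L ^ n)" for x
    unfolding Q_def using L by (subst emeasure_euc_box) (auto simp: ennreal_power)
  have sub: "(\<Union>x\<in>F. Q x) \<subseteq> euc_cball n (R + sqrt (real n) * L) (euc_zero n)"
  proof safe
    fix x y assume x: "x \<in> F" and y: "y \<in> Q x"
    have "euc_dist n y x \<le> sqrt (real n) * L"
      using y L by (intro euc_dist_le_sqrt) (force simp: Q_def PiE_iff abs_le_iff)+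
    then have "euc_dist n y (euc_zero n) \<le> R + sqrt (real n) * L"
      using euc_dist_triangle[where n = n and x = y and z = "euc_zero n" and y = x] F(3)[OF x] by linarith
    with y show "y \<in> euc_cball n (R + sqrt (real n) * L) (euc_zero n)"
      by (auto simp: Q_def euc_cball_def euc_def PiE_iff)
  qed
  have pos: "R + sqrt (real n) * L > 0" using R L n by (simp add: add_nonneg_pos)
  have "ennreal (real (card F) * L ^ n) = (\<Sum>x\<in>F. emeasure (euc_lborel n) (Q x))"
    using L by (simp add: Qv ennreal_mult ennreal_of_nat_eq_real_of_nat)
  also have "\<dots> = emeasure (euc_lborel n) (\<Union>x\<in>F. Q x)"
    using Qm by (intro sum_emeasure disj F) auto
  also have "\<dots> \<le> emeasure (euc_lborel n) (euc_cball n (R + sqrt (real n) * L) (euc_zero n))"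
    by (intro emeasure_mono sub euc_cball_measurable)
  also have "\<dots> = ennreal ((R + sqrt (real n) * L) ^ n * ball_vol n)"
    using n pos by (rule emeasure_euc_cball)
  finally show ?thesis
    using pos by (subst (asm) ennreal_le_iff) auto
qed

lemma unit_covering_periodize:
  assumes L: "L > 0" and C: "C \<subseteq> euc n"
    and cov: "(\<Pi>\<^sub>E i\<in>{..<n}. {0..<L}) \<subseteq> (\<Union>c\<in>C. euc_cball n 1 c)"
  shows "unit_covering n (\<Union>c\<in>C. periodize n L c)"
  unfolding unit_covering_def
proof
  show "(\<Union>c\<in>C. periodize n L c) \<subseteq> euc n" by (auto simp: periodize_def)
  show "euc n = (\<Union>x\<in>\<Union>c\<in>C. periodize n L c. euc_cball n 1 x)"
  proof (intro equalityI subsetI)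
    fix y assume y: "y \<in> euc n"
    define k where "k i = \<lfloor>y i / L\<rfloor>" for i
    define y' where "y' = (\<lambda>i\<in>{..<n}. y i - L * of_int (k i))"
    have "0 \<le> y i - L * of_int (k i)" "y i - L * of_int (k i) < L" for i
    proof -
      have "of_int (k i) \<le> y i / L" "y i / L < of_int (k i) + 1" unfolding k_def by linarith+
      then show "0 \<le> y i - L * of_int (k i)" "y i - L * of_int (k i) < L"
        using L by (simp_all add: field_simps)
    qed
    then have "y' \<in> (\<Pi>\<^sub>E i\<in>{..<n}. {0..<L})" by (auto simp: y'_def)
    then obtain c where c: "c \<in> C" "y' \<in> euc_cball n 1 c" using cov by auto
    define x where "x = (\<lambda>i\<in>{..<n}. c i + L * of_int (k i))"
    have "x \<in> periodize n L c" by (auto simp: x_def periodize_def euc_def)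
    moreover have "euc_dist n y x = euc_dist n y' c"
      by (rule L2_set_cong) (auto simp: x_def y'_def)
    then have "y \<in> euc_cball n 1 x" using y c by (simp add: euc_cball_def)
    ultimately show "y \<in> (\<Union>x\<in>\<Union>c\<in>C. periodize n L c. euc_cball n 1 x)" using c by blast
  qed (auto simp: euc_cball_def)
qed

text \<open>
  Only centres within \<open>R + 1\<close> of the origin contribute to the density at radius \<open>R\<close>, each at most
  one full ball. The boundary effects change \<open>R\<close> by a constant \<open>K\<close> and disappear in the limit.
\<close>

lemma min_covering_density_le_cube:
  assumes n: "n > 0" and L: "L > 0" and C: "finite C" "C \<subseteq> euc n"
    and cov: "(\<Pi>\<^sub>E i\<in>{..<n}. {0..<L}) \<subseteq> (\<Union>c\<in>C. euc_cball n 1 c)"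
  shows "min_covering_density n \<le> ennreal (real (card C) * ball_vol n / L ^ n)"
proof -
  define X where "X = (\<Union>c\<in>C. periodize n L c)"
  define K where "K = 1 + sqrt (real n) * L"
  define d where "d = real (card C) * ball_vol n / L ^ n"
  let ?v = "ball_vol n" and ?B = "\<lambda>R. euc_cball n R (euc_zero n)"
  let ?f = "\<lambda>R x. emeasure (euc_lborel n) (euc_cball n 1 x \<inter> ?B R)"
  have v: "?v > 0" using ball_vol_pos[OF n] .
  have "unit_covering n X" unfolding X_def by (rule unit_covering_periodize) fact+
  then have "min_covering_density n \<le> covering_density n X"
    unfolding min_covering_density_def by (intro INF_lower) simp
  also have "covering_density n X \<le> Limsup at_top (\<lambda>R::real. ennreal (d * (1 + K / R) ^ n))"
    unfolding covering_density_def
  proof (intro Limsup_mono eventually_mono[OF eventually_gt_at_top[of 0]])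
    fix R :: real assume R: "R > 0"
    have "(\<Sum>\<^sub>\<infinity>x\<in>X. ?f R x) \<le> ennreal (d * (R + K) ^ n * ?v)"
    proof (rule infsum_le_finite_sums)
      fix F assume F: "finite F" "F \<subseteq> X"
      define G where "G = {x \<in> F. euc_dist n x (euc_zero n) \<le> R + 1}"
      have "?f R x = 0" if "x \<in> F - G" for x
      proof -
        have "euc_cball n 1 x \<inter> ?B R = {}"
        proof safe
          fix y assume "y \<in> euc_cball n 1 x" "y \<in> ?B R"
          then have "euc_dist n x (euc_zero n) \<le> 1 + R"
            using euc_dist_triangle[where n = n and x = x and z = "euc_zero n" and y = y] euc_dist_commute[where n = n and x = x and y = y]
            by (simp add: euc_cball_def)
          then show "y \<in> {}" using that by (simp add: G_def)
        qed
        then show ?thesis by simp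
      qed
      then have "(\<Sum>x\<in>F. ?f R x) = (\<Sum>x\<in>G. ?f R x)"
        using F by (intro sum.mono_neutral_right) (auto simp: G_def)
      also have "\<dots> \<le> (\<Sum>x\<in>G. ennreal ?v)"
      proof (rule sum_mono)
        fix x
        have "?f R x \<le> emeasure (euc_lborel n) (euc_cball n 1 x)"
          by (intro emeasure_mono euc_cball_measurable) auto
        then show "?f R x \<le> ennreal ?v" using n by (simp add: emeasure_euc_cball)
      qed
      also have "\<dots> = ennreal (real (card G) * ?v)"
        by (simp add: ennreal_mult ennreal_of_nat_eq_real_of_nat)
      also have "\<dots> \<le> ennreal (d * (R + K) ^ n * ?v)"
      proof (intro ennreal_leI mult_right_mono)
        have "G = (\<Union>c\<in>C. G \<inter> periodize n L c)" using F by (auto simp: G_def X_def)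
        then have "card G \<le> (\<Sum>c\<in>C. card (G \<inter> periodize n L c))"
          using card_UN_le[OF C(1)] by metis
        then have "real (card G) \<le> (\<Sum>c\<in>C. real (card (G \<inter> periodize n L c)))"
          by (metis of_nat_mono of_nat_sum)
        also have "\<dots> \<le> (\<Sum>c\<in>C. (R + K) ^ n * ?v / L ^ n)"
        proof (rule sum_mono)
          fix c
          have "real (card (G \<inter> periodize n L c)) * L ^ n \<le> (R + 1 + sqrt (real n) * L) ^ n * ?v"
            using F n L R by (intro card_periodize_in_ball_le[where c = c]) (auto simp: G_def)
          then show "real (card (G \<inter> periodize n L c)) \<le> (R + K) ^ n * ?v / L ^ n"
            using L by (simp add: pos_le_divide_eq K_def add.assoc)
        qed
        also have "\<dots> = d * (R + K) ^ n" by (simp add: d_def)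
        finally show "real (card G) \<le> d * (R + K) ^ n" .
      qed simp
      finally show "(\<Sum>x\<in>F. ?f R x) \<le> ennreal (d * (R + K) ^ n * ?v)" .
    qed (simp add: nonneg_summable_on_complete)
    then have "(\<Sum>\<^sub>\<infinity>x\<in>X. ?f R x) / emeasure (euc_lborel n) (?B R)
        \<le> ennreal (d * (R + K) ^ n * ?v) / ennreal (R ^ n * ?v)"
      using n R by (simp only: emeasure_euc_cball divide_right_mono_ennreal)
    also have "\<dots> = ennreal (d * (R + K) ^ n * ?v / (R ^ n * ?v))"
      using R v L by (intro divide_ennreal) (auto simp: d_def K_def)
    also have "d * (R + K) ^ n * ?v / (R ^ n * ?v) = d * (1 + K / R) ^ n"
    proof -
      have "1 + K / R = (R + K) / R" using R by (simp add: field_simps)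
      then show ?thesis using v by (simp add: power_divide)
    qed
    finally show "(\<Sum>\<^sub>\<infinity>x\<in>X. ?f R x) / emeasure (euc_lborel n) (?B R) \<le> ennreal (d * (1 + K / R) ^ n)" .
  qed
  also have "\<dots> = ennreal d"
  proof (rule lim_imp_Limsup)
    have "((\<lambda>R. K / R) \<longlongrightarrow> 0) at_top"
      by (intro tendsto_divide_0[OF tendsto_const] filterlim_at_top_imp_at_infinity filterlim_ident)
    then have "((\<lambda>R. d * (1 + K / R) ^ n) \<longlongrightarrow> d * (1 + 0) ^ n) at_top" by (intro tendsto_intros)
    then show "((\<lambda>R. ennreal (d * (1 + K / R) ^ n)) \<longlongrightarrow> ennreal d) at_top"
      by (intro tendsto_ennrealI) simp
  qed simp
  finally show ?thesis by (simp add: d_def)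
qed

section \<open>Choosing the centres by averaging\<close>

lemma (in prob_space) exists_le_expectation:
  fixes X :: "'a \<Rightarrow> real"
  assumes "integrable M X"
  shows "\<exists>z\<in>space M. X z \<le> expectation X"
proof (rule ccontr)
  assume "\<not> ?thesis"
  then have "AE z in M. expectation X < X z" by (intro AE_I2) auto
  from expectation_greater[OF assms this] show False by simp
qed

text \<open>
  For independent random \<open>zs\<close> the expectation of \<open>t\<^sub>i\<close> to the number of hits of \<open>S\<^sub>i\<close> is
  \<open>(1 + (t\<^sub>i - 1) P(S\<^sub>i))\<^sup>N\<close>, which is at most the exponential on the right. Drawing the points one at
  a time, each not worse than its average for the potential that the remaining ones still have to
  multiply, avoids product spaces. A factor \<open>t\<^sub>i < 1\<close> penalises too few hits, a factor \<open>t\<^sub>i > 1\<close> too many.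
\<close>

lemma (in prob_space) exists_list_weighted_counts_le:
  fixes S :: "'i \<Rightarrow> 'a set" and w t :: "'i \<Rightarrow> real"
  assumes "finite I" and S: "\<And>i. i \<in> I \<Longrightarrow> S i \<in> events" and w: "\<And>i. i \<in> I \<Longrightarrow> 0 \<le> w i"
    and t: "\<And>i. i \<in> I \<Longrightarrow> 0 \<le> t i"
  shows "\<exists>zs. length zs = N \<and> set zs \<subseteq> space M \<and>
    (\<Sum>i\<in>I. w i * t i ^ length (filter (\<lambda>z. z \<in> S i) zs))
      \<le> (\<Sum>i\<in>I. w i * exp (real N * (t i - 1) * prob (S i)))"
  using w
proof (induction N arbitrary: w)
  case 0
  show ?case by (intro exI[of _ "[]"]) simp
next
  case (Suc N)
  define a where "a i = (t i - 1) * prob (S i)" for i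
  define c where "c i = w i * exp (real N * a i)" for i
  define X where "X z = (\<Sum>i\<in>I. c i * (1 + (t i - 1) * indicator (S i) z))" for z
  have c: "c i \<ge> 0" if "i \<in> I" for i using Suc.prems[OF that] by (simp add: c_def)
  have int: "integrable M (\<lambda>z. c i * (1 + (t i - 1) * indicator (S i) z))" if "i \<in> I" for i
    using S[OF that] by (intro integrable_mult_right Bochner_Integration.integrable_add) (auto simp: emeasure_eq_measure)
  have E: "expectation (\<lambda>z. c i * (1 + (t i - 1) * indicator (S i) z)) = c i * (1 + a i)" if "i \<in> I" for i
    using S[OF that] by (simp add: prob_space a_def emeasure_eq_measure Bochner_Integration.integral_add)
  have "integrable M X" unfolding X_def using int by (intro Bochner_Integration.integrable_sum)
  then obtain z where z: "z \<in> space M" "X z \<le> expectation X" using exists_le_expectation by blast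
  define w' where "w' i = w i * (1 + (t i - 1) * indicator (S i) z)" for i
  have "0 \<le> w' i" if "i \<in> I" for i
    using t[OF that] Suc.prems[OF that] by (auto simp: w'_def indicator_def)
  from Suc.IH[of w', OF this] obtain zs where zs: "length zs = N" "set zs \<subseteq> space M"
    "(\<Sum>i\<in>I. w' i * t i ^ length (filter (\<lambda>z. z \<in> S i) zs))
      \<le> (\<Sum>i\<in>I. w' i * exp (real N * (t i - 1) * prob (S i)))" by blast
  have "(\<Sum>i\<in>I. w i * t i ^ length (filter (\<lambda>z. z \<in> S i) (z # zs)))
      = (\<Sum>i\<in>I. w' i * t i ^ length (filter (\<lambda>z. z \<in> S i) zs))"
    by (intro sum.cong) (auto simp: w'_def)
  also have "\<dots> \<le> (\<Sum>i\<in>I. w' i * exp (real N * (t i - 1) * prob (S i)))" by (rule zs(3))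
  also have "\<dots> = X z" by (simp add: X_def w'_def c_def a_def mult_ac)
  also have "\<dots> \<le> expectation X" by (rule z(2))
  also have "expectation X = (\<Sum>i\<in>I. c i * (1 + a i))"
    unfolding X_def by (subst Bochner_Integration.integral_sum[OF int]) (simp_all only: E cong: sum.cong)
  also have "\<dots> \<le> (\<Sum>i\<in>I. c i * exp (a i))"
    by (intro sum_mono mult_left_mono exp_ge_add_one_self c)
  also have "\<dots> = (\<Sum>i\<in>I. w i * exp (real (Suc N) * (t i - 1) * prob (S i)))"
    by (simp add: c_def a_def algebra_simps flip: exp_add)
  finally show ?case using zs z by (intro exI[of _ "z # zs"]) auto
qed

section \<open>The cap estimate\<close>

lemma euc_dist_le_iff:
  "0 \<le> r \<Longrightarrow> euc_dist n x y \<le> r \<longleftrightarrow> (\<Sum>i<n. (x i - y i)\<^sup>2) \<le> r\<^sup>2"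
  unfolding L2_set_def using real_sqrt_le_iff[of "\<Sum>i<n. (x i - y i)\<^sup>2" "r\<^sup>2"] by simp

text \<open>
  A point \<open>z\<close> of the difference satisfies \<open>2 \<langle>z - u, y - u\<rangle> \<le> - s\<close>, since otherwise it would be closer
  to \<open>y\<close>; so moving the centre from \<open>u\<close> away from \<open>y\<close> reduces the squared distance to \<open>z\<close>. The
  reduction \<open>\<tau> s - \<tau>\<^sup>2 \<rho>\<^sup>2\<close> obtained by a displacement of \<open>\<tau>\<close> times \<open>u - y\<close> is largest for
  \<open>\<tau> = s / (2 \<rho>\<^sup>2)\<close>.
\<close>

lemma cball_diff_cball_subset:
  fixes s \<epsilon> \<rho> :: real
  defines "\<tau> \<equiv> s / (2 * \<rho>\<^sup>2)"
  assumes s: "0 < s" "s \<le> 1/5" and \<epsilon>: "\<epsilon> \<le> s / 4" and \<rho>: "0 < \<rho>" "\<rho>\<^sup>2 \<le> s / 4"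
    and yu: "euc_dist n y u \<le> \<rho>"
  shows "euc_cball n (1 - s) u - euc_cball n (1 - \<epsilon>) y
    \<subseteq> euc_cball n (exp (- (s\<^sup>2 / (8 * \<rho>\<^sup>2)))) (\<lambda>i. u i - \<tau> * (y i - u i))"
proof
  fix z assume z: "z \<in> euc_cball n (1 - s) u - euc_cball n (1 - \<epsilon>) y"
  have zu: "(\<Sum>i<n. (z i - u i)\<^sup>2) \<le> (1 - s)\<^sup>2"
    using z s by (auto simp: euc_cball_def euc_dist_le_iff)
  have zy: "(\<Sum>i<n. (z i - y i)\<^sup>2) \<ge> (1 - \<epsilon>)\<^sup>2"
    using z s \<epsilon> by (auto simp: euc_cball_def euc_dist_le_iff)
  have yu': "(\<Sum>i<n. (y i - u i)\<^sup>2) \<le> \<rho>\<^sup>2"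
    using yu \<rho> by (simp add: euc_dist_le_iff)
  have \<tau>: "\<tau> > 0" using s \<rho> by (simp add: \<tau>_def)
  have "(1 - s/4)\<^sup>2 \<le> (1 - \<epsilon>)\<^sup>2" using s \<epsilon> by (intro power_mono) auto
  moreover have "s * s \<le> s * (1/5)" using s by (intro mult_left_mono) auto
  moreover have "(1 - s/4)\<^sup>2 = 1 - s/2 + s * s / 16" "(1 - s)\<^sup>2 = 1 - 2 * s + s * s"
    by (simp_all add: power2_eq_square algebra_simps)
  ultimately have gap: "s \<le> (1 - \<epsilon>)\<^sup>2 - (1 - s)\<^sup>2 - \<rho>\<^sup>2"
    using \<rho>(2) s(1) by linarith
  \<comment> \<open>Eliminating the inner product: \<open>|a + \<tau> w|\<^sup>2 = (1 + \<tau>) |a|\<^sup>2 - \<tau> |a - w|\<^sup>2 + (\<tau> + \<tau>\<^sup>2) |w|\<^sup>2\<close> with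
      \<open>a = z - u\<close> and \<open>w = y - u\<close>.\<close>
  have "(\<Sum>i<n. (z i - (u i - \<tau> * (y i - u i)))\<^sup>2)
      = (\<Sum>i<n. (1 + \<tau>) * (z i - u i)\<^sup>2 - \<tau> * (z i - y i)\<^sup>2 + (\<tau> + \<tau>\<^sup>2) * (y i - u i)\<^sup>2)"
    by (intro sum.cong refl) (simp add: power2_eq_square algebra_simps)
  also have "\<dots> = (1 + \<tau>) * (\<Sum>i<n. (z i - u i)\<^sup>2) - \<tau> * (\<Sum>i<n. (z i - y i)\<^sup>2)
      + (\<tau> + \<tau>\<^sup>2) * (\<Sum>i<n. (y i - u i)\<^sup>2)"
    by (simp add: sum.distrib sum_subtractf sum_distrib_left)
  also have "\<dots> \<le> (1 + \<tau>) * (1 - s)\<^sup>2 - \<tau> * (1 - \<epsilon>)\<^sup>2 + (\<tau> + \<tau>\<^sup>2) * \<rho>\<^sup>2"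
    using \<tau> by (intro add_mono diff_mono mult_left_mono zu zy yu') auto
  also have "\<dots> = (1 - s)\<^sup>2 - \<tau> * ((1 - \<epsilon>)\<^sup>2 - (1 - s)\<^sup>2 - \<rho>\<^sup>2) + \<tau>\<^sup>2 * \<rho>\<^sup>2"
    by (simp add: algebra_simps)
  also have "\<dots> \<le> 1 - \<tau> * s + \<tau>\<^sup>2 * \<rho>\<^sup>2"
    using \<tau> s by (intro add_right_mono diff_mono mult_left_mono gap) (auto intro: power_le_one)
  also have "\<dots> = 1 + - (s\<^sup>2 / (4 * \<rho>\<^sup>2))"
    using \<rho> by (simp add: \<tau>_def power2_eq_square field_simps)
  also have "\<dots> \<le> exp (- (s\<^sup>2 / (4 * \<rho>\<^sup>2)))" by (rule exp_ge_add_one_self)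
  also have "\<dots> = (exp (- (s\<^sup>2 / (8 * \<rho>\<^sup>2))))\<^sup>2"
    by (simp add: power2_eq_square flip: exp_add)
  finally show "z \<in> euc_cball n (exp (- (s\<^sup>2 / (8 * \<rho>\<^sup>2)))) (\<lambda>i. u i - \<tau> * (y i - u i))"
    using z by (simp add: euc_cball_def euc_dist_le_iff)
qed

section \<open>Covering a cube\<close>

text \<open>
  The points of the cubic lattice of side \<open>1/m\<close> in the half-open cube of side \<open>L\<close>; being integral,
  \<open>L\<close> is a multiple of the side, so the cells of these points tile the cube exactly.
\<close>

definition grid :: "nat \<Rightarrow> nat \<Rightarrow> nat \<Rightarrow> (nat \<Rightarrow> real) set" where
  "grid n m L = (\<Pi>\<^sub>E i\<in>{..<n}. (\<lambda>j. real j / real m) ` {..<m * L})"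

definition corner :: "nat \<Rightarrow> nat \<Rightarrow> (nat \<Rightarrow> real) \<Rightarrow> nat \<Rightarrow> real" where
  "corner n m y = (\<lambda>i\<in>{..<n}. real (nat \<lfloor>real m * y i\<rfloor>) / real m)"

lemma finite_grid: "finite (grid n m L)"
  unfolding grid_def by (intro finite_PiE) auto

lemma card_grid: "m > 0 \<Longrightarrow> card (grid n m L) = (m * L) ^ n"
  unfolding grid_def by (subst card_PiE) (auto simp: card_image inj_on_def)

lemma grid_subset_cube: "m > 0 \<Longrightarrow> grid n m L \<subseteq> (\<Pi>\<^sub>E i\<in>{..<n}. {0..<real L})"
proof -
  assume m: "m > 0"
  have "real j / real m < real L" if "j < m * L" for j
    using that m by (simp add: pos_divide_less_eq mult.commute flip: of_nat_mult)
  then show ?thesis unfolding grid_def by (intro PiE_mono) auto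
qed

lemma corner_in_grid:
  assumes "m > 0" "y \<in> (\<Pi>\<^sub>E i\<in>{..<n}. {0..<real L})"
  shows "corner n m y \<in> grid n m L"
proof -
  have "nat \<lfloor>real m * y i\<rfloor> < m * L" if "i < n" for i
  proof -
    have "0 \<le> y i" "y i < real L" using assms that by (auto simp: PiE_iff)
    then have "0 \<le> real m * y i" "real m * y i < real m * real L" using assms by auto
    then show ?thesis by (simp add: nat_less_iff floor_less_iff)
  qed
  then show ?thesis by (auto simp: corner_def grid_def)
qed

lemma euc_dist_corner_le:
  assumes "m > 0" "y \<in> (\<Pi>\<^sub>E i\<in>{..<n}. {0..<real L})"
  shows "euc_dist n y (corner n m y) \<le> sqrt (real n) / real m"
proof -
  have "\<bar>y i - corner n m y i\<bar> \<le> 1 / real m" if "i < n" for i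
  proof -
    have "0 \<le> y i" using assms that by (auto simp: PiE_iff)
    then have "corner n m y i = of_int \<lfloor>real m * y i\<rfloor> / real m" using that by (simp add: corner_def)
    then have "y i - corner n m y i = (real m * y i - of_int \<lfloor>real m * y i\<rfloor>) / real m"
      using assms(1) by (simp add: field_simps)
    moreover have "\<bar>real m * y i - of_int \<lfloor>real m * y i\<rfloor>\<bar> \<le> 1"
      by linarith
    ultimately show ?thesis
      using divide_right_mono[of "\<bar>real m * y i - of_int \<lfloor>real m * y i\<rfloor>\<bar>" 1 "real m"]
      by (simp only: abs_divide abs_of_nat of_nat_0_le_iff)
  qed
  from euc_dist_le_sqrt[where x = y and y = "corner n m y", OF this] show ?thesis by simp
qed

lemma abs_diff_le_euc_dist: "i < n \<Longrightarrow> \<bar>x i - y i\<bar> \<le> euc_dist n x y"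
  using member_le_L2_set[of "{..<n}" i "\<lambda>i. \<bar>x i - y i\<bar>"] by (simp add: L2_set_def)

text \<open>
  The centres are drawn from a cube enlarged by \<open>1\<close> on each side, so that the balls about grid points
  keep their full volume; \<open>d\<close> is then the mean number of centres in a unit ball, and \<open>\<delta>\<close> bounds the
  volume of a cap relative to a unit ball. The last two terms of the bound count the bad coarse and
  the bad fine points. The potential has base \<open>\<theta> < 1\<close> for coarse points, where few hits are bad, and base
  \<open>1/\<delta>\<close> for fine points, where many hits are bad: this base turns \<open>k\<close> hits into \<open>\<delta>\<^bsup>-k\<^esup>\<close> at the price
  of a factor \<open>e\<^sup>d\<close> only.
\<close>

lemma covering_of_cube:
  fixes n L m m' k N :: nat and s \<theta> :: real
  defines "d \<equiv> real N * ball_vol n / (real L + 2) ^ n"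
    and "\<delta> \<equiv> exp (- (s\<^sup>2 * (real m)\<^sup>2 / (8 * real n))) ^ n"
  assumes n: "n > 0" and m: "m > 0" "m' > 0" and s: "0 < s" "s \<le> 1/5"
    and fine: "sqrt (real n) / real m' \<le> s / 4" and coarse: "real n / (real m)\<^sup>2 \<le> s / 4"
    and \<theta>: "0 < \<theta>" "\<theta> \<le> 1"
  shows "\<exists>C. finite C \<and> C \<subseteq> euc n \<and>
    (\<Pi>\<^sub>E i\<in>{..<n}. {0..<real L}) \<subseteq> (\<Union>c\<in>C. euc_cball n 1 c) \<and>
    real (card C) \<le> real N
      + real ((m * L) ^ n) * ((1 / \<theta>) ^ k * exp (- (1 - \<theta>) * (1 - s) ^ n * d))
      + real ((m' * L) ^ n) * (\<delta> ^ k * exp d)"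
proof -
  define \<rho> where "\<rho> = sqrt (real n) / real m"
  define \<epsilon> where "\<epsilon> = sqrt (real n) / real m'"
  have \<rho>: "0 < \<rho>" "\<rho>\<^sup>2 = real n / (real m)\<^sup>2" "\<rho>\<^sup>2 \<le> s / 4"
    using n m coarse by (simp_all add: \<rho>_def power_divide)
  have \<epsilon>: "\<epsilon> \<le> s / 4" using fine by (simp add: \<epsilon>_def)
  have "\<rho> \<le> 1/2"
  proof (rule power2_le_imp_le)
    show "\<rho>\<^sup>2 \<le> (1/2)\<^sup>2" using \<rho>(3) s by (simp add: power2_eq_square)
  qed simp
  then have \<rho>\<epsilon>: "\<rho> + \<epsilon> \<le> 1" using \<epsilon> s by linarith
  have \<delta>: "0 < \<delta>" "\<delta> \<le> 1" by (simp_all add: \<delta>_def power_le_one)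
  define v where "v = ball_vol n"
  define V where "V = (real L + 2) ^ n"
  have V: "V > 0" by (simp add: V_def)
  define M where "M = euc_lborel n"
  define Q where "Q = (\<Pi>\<^sub>E i\<in>{..<n}. {-1..real L + 1})"
  have Qm: "Q \<in> sets M" unfolding Q_def M_def by (rule sets_euc_box) auto
  have Qv: "emeasure M Q = ennreal V"
  proof -
    have "emeasure lborel {-1..real L + 1} = ennreal (real L + 2)" by simp
    then show ?thesis unfolding Q_def M_def V_def
      by (subst emeasure_euc_box) (simp, simp only: prod_constant card_lessThan ennreal_power
          add_nonneg_nonneg of_nat_0_le_iff zero_le_numeral)
  qed
  have Qv': "measure M Q = V" using V by (simp add: measure_def Qv)
  interpret U: prob_space "uniform_measure M Q"
    using V by (intro prob_space_uniform_measure) (auto simp: Qv)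
  have prob: "U.prob S = measure M (Q \<inter> S) / V" if "S \<in> sets M" for S
    using that V Qm by (subst measure_uniform_measure) (auto simp: Qv Qv')
  have ball: "emeasure M (euc_cball n r c) = ennreal (r ^ n * v)" "measure M (euc_cball n r c) = r ^ n * v"
    if "r > 0" for r c
    using emeasure_euc_cball[OF n that, of c] that by (simp_all add: M_def v_def measure_def)
  note ball_sets = euc_cball_measurable[of n, folded M_def]

  \<comment> \<open>\<open>A u\<close>: centres whose unit ball nearly covers the neighbourhood of the coarse point \<open>u\<close>;
      \<open>B y\<close>: those among them that nevertheless fail to cover the neighbourhood of the fine point \<open>y\<close>.\<close>
  define A where "A u = euc_cball n (1 - s) u" for u
  define B where "B y = A (corner n m y) - euc_cball n (1 - \<epsilon>) y" for y
  have cube: "y \<in> (\<Pi>\<^sub>E i\<in>{..<n}. {0..<real L})" if "y \<in> grid n j L" "j > 0" for y j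
    using grid_subset_cube[OF that(2)] that by auto
  have A_sets: "A u \<in> sets M" and B_sets: "B y \<in> sets M" for u y
    unfolding B_def A_def by (intro sets.Diff ball_sets)+
  have probA: "U.prob (A u) = (1 - s) ^ n * v / V" if u: "u \<in> grid n m L" for u
  proof -
    have "A u \<subseteq> Q"
    proof
      fix z assume z: "z \<in> A u"
      have "\<bar>z i - u i\<bar> \<le> 1" if "i < n" for i
        using abs_diff_le_euc_dist[OF that, of z u] z s by (simp add: A_def euc_cball_def)
      moreover have "0 \<le> u i" "u i < real L" if "i < n" for i
        using cube[OF u m(1)] that by (auto simp: PiE_iff)
      ultimately have "z i \<in> {-1..real L + 1}" if "i < n" for i
        using that by (force simp: abs_le_iff)
      then show "z \<in> Q" using z by (auto simp: Q_def A_def euc_cball_def euc_def PiE_iff)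
    qed
    then have "Q \<inter> A u = A u" by auto
    then show ?thesis using s by (subst prob) (simp_all add: A_def ball ball_sets)
  qed
  have probB: "U.prob (B y) \<le> \<delta> * v / V" if y: "y \<in> grid n m' L" for y
  proof -
    let ?r = "exp (- (s\<^sup>2 / (8 * \<rho>\<^sup>2)))"
    let ?c = "\<lambda>i. corner n m y i - s / (2 * \<rho>\<^sup>2) * (y i - corner n m y i)"
    have "B y \<subseteq> euc_cball n ?r ?c" unfolding B_def A_def
      using euc_dist_corner_le[OF m(1) cube[OF y m(2)]]
      by (intro cball_diff_cball_subset s \<epsilon> \<rho>) (simp add: \<rho>_def)
    then have "measure M (Q \<inter> B y) \<le> measure M (euc_cball n ?r ?c)"
      by (intro measure_mono_fmeasurable fmeasurableI sets.Int Qm B_sets ball_sets) (auto simp: ball)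
    also have "\<dots> = \<delta> * v"
      using \<rho> n m by (simp add: ball \<delta>_def)
    finally show ?thesis
      using V by (subst prob) (auto simp: B_sets intro!: divide_right_mono)
  qed

  define I where "I = grid n m L <+> grid n m' L"
  define S where "S = case_sum A B"
  define w where "w = case_sum (\<lambda>_::nat \<Rightarrow> real. (1 / \<theta>) ^ k) (\<lambda>_::nat \<Rightarrow> real. \<delta> ^ k)"
  define t where "t = case_sum (\<lambda>_::nat \<Rightarrow> real. \<theta>) (\<lambda>_::nat \<Rightarrow> real. 1 / \<delta>)"
  have "finite I" by (simp add: I_def finite_grid)
  moreover have "S i \<in> U.events" for i
    by (auto simp: S_def A_sets B_sets split: sum.split)
  moreover have "0 \<le> w i" "0 \<le> t i" for i
    using \<theta> \<delta> by (auto simp: w_def t_def split: sum.split)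
  ultimately have "\<exists>zs. length zs = N \<and> set zs \<subseteq> space (uniform_measure M Q) \<and>
    (\<Sum>i\<in>I. w i * t i ^ length (filter (\<lambda>z. z \<in> S i) zs))
      \<le> (\<Sum>i\<in>I. w i * exp (real N * (t i - 1) * U.prob (S i)))"
    by (intro U.exists_list_weighted_counts_le)
  then obtain zs where zs: "length zs = N" "set zs \<subseteq> euc n"
    and le: "(\<Sum>i\<in>I. w i * t i ^ length (filter (\<lambda>z. z \<in> S i) zs))
      \<le> (\<Sum>i\<in>I. w i * exp (real N * (t i - 1) * U.prob (S i)))"
    by (auto simp: M_def space_euc_lborel)

  define hits where "hits T = length (filter (\<lambda>z. z \<in> T) zs)" for T
  define badU where "badU = {u \<in> grid n m L. hits (A u) < k}"
  define badF where "badF = {y \<in> grid n m' L. hits (B y) \<ge> k}"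
  have fin: "finite badU" "finite badF" by (simp_all add: badU_def badF_def finite_grid)
  have "real (card badU) = (\<Sum>u\<in>badU. 1)" by simp
  also have "\<dots> \<le> (\<Sum>u\<in>badU. (1 / \<theta>) ^ k * \<theta> ^ hits (A u))"
  proof (rule sum_mono)
    fix u assume "u \<in> badU"
    then have "\<theta> ^ k \<le> \<theta> ^ hits (A u)" using \<theta> by (intro power_decreasing) (auto simp: badU_def)
    then show "1 \<le> (1 / \<theta>) ^ k * \<theta> ^ hits (A u)" using \<theta> by (simp add: power_one_over field_simps)
  qed
  also have "\<dots> \<le> (\<Sum>u\<in>grid n m L. (1 / \<theta>) ^ k * \<theta> ^ hits (A u))"
    using \<theta> by (intro sum_mono2 finite_grid) (auto simp: badU_def)
  finally have cardU: "real (card badU) \<le> (\<Sum>u\<in>grid n m L. (1 / \<theta>) ^ k * \<theta> ^ hits (A u))" .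
  have "real (card badF) = (\<Sum>y\<in>badF. 1)" by simp
  also have "\<dots> \<le> (\<Sum>y\<in>badF. \<delta> ^ k * (1 / \<delta>) ^ hits (B y))"
  proof (rule sum_mono)
    fix y assume "y \<in> badF"
    then have "\<delta> ^ hits (B y) \<le> \<delta> ^ k" using \<delta> by (intro power_decreasing) (auto simp: badF_def)
    then show "1 \<le> \<delta> ^ k * (1 / \<delta>) ^ hits (B y)" using \<delta> by (simp add: power_one_over field_simps)
  qed
  also have "\<dots> \<le> (\<Sum>y\<in>grid n m' L. \<delta> ^ k * (1 / \<delta>) ^ hits (B y))"
    using \<delta> by (intro sum_mono2 finite_grid) (auto simp: badF_def)
  finally have cardF: "real (card badF) \<le> (\<Sum>y\<in>grid n m' L. \<delta> ^ k * (1 / \<delta>) ^ hits (B y))" .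

  have "real (card badU) + real (card badF) \<le> (\<Sum>i\<in>I. w i * t i ^ hits (S i))"
    using cardU cardF by (simp add: I_def sum.Plus finite_grid w_def t_def S_def)
  also have "\<dots> \<le> (\<Sum>i\<in>I. w i * exp (real N * (t i - 1) * U.prob (S i)))"
    using le by (simp add: hits_def)
  also have "\<dots> = (\<Sum>u\<in>grid n m L. (1 / \<theta>) ^ k * exp (real N * (\<theta> - 1) * U.prob (A u)))
      + (\<Sum>y\<in>grid n m' L. \<delta> ^ k * exp (real N * (1 / \<delta> - 1) * U.prob (B y)))"
    by (simp add: I_def sum.Plus finite_grid w_def t_def S_def)
  also have "\<dots> \<le> (\<Sum>u\<in>grid n m L. (1 / \<theta>) ^ k * exp (- (1 - \<theta>) * (1 - s) ^ n * d))
      + (\<Sum>y\<in>grid n m' L. \<delta> ^ k * exp d)"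
  proof (intro add_mono sum_mono)
    fix u assume u: "u \<in> grid n m L"
    have "real N * (\<theta> - 1) * U.prob (A u) = - (1 - \<theta>) * (1 - s) ^ n * d"
      unfolding probA[OF u] d_def v_def V_def by (simp add: field_simps)
    then show "(1 / \<theta>) ^ k * exp (real N * (\<theta> - 1) * U.prob (A u))
        \<le> (1 / \<theta>) ^ k * exp (- (1 - \<theta>) * (1 - s) ^ n * d)" by (simp only: order_refl)
  next
    fix y assume y: "y \<in> grid n m' L"
    have "real N * (1 / \<delta> - 1) * U.prob (B y) \<le> real N * (1 / \<delta>) * (\<delta> * v / V)"
      using \<delta> by (intro mult_mono probB[OF y] mult_left_mono) auto
    also have "\<dots> = d" using \<delta> by (simp add: d_def v_def V_def)
    finally show "\<delta> ^ k * exp (real N * (1 / \<delta> - 1) * U.prob (B y)) \<le> \<delta> ^ k * exp d"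
      using \<delta> by (intro mult_left_mono) auto
  qed
  also have "\<dots> = real ((m * L) ^ n) * ((1 / \<theta>) ^ k * exp (- (1 - \<theta>) * (1 - s) ^ n * d))
      + real ((m' * L) ^ n) * (\<delta> ^ k * exp d)"
    using m by (simp add: card_grid)
  finally have bad: "real (card badU) + real (card badF) \<le>
      real ((m * L) ^ n) * ((1 / \<theta>) ^ k * exp (- (1 - \<theta>) * (1 - s) ^ n * d))
      + real ((m' * L) ^ n) * (\<delta> ^ k * exp d)" .

  define C where "C = set zs \<union> badU \<union> badF"
  have "real (card C) \<le> real N + (real (card badU) + real (card badF))"
    using card_Un_le[of "set zs \<union> badU" badF] card_Un_le[of "set zs" badU] card_length[of zs] zs(1)
    unfolding C_def by linarith
  moreover have "finite C" by (simp add: C_def fin)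
  moreover have "C \<subseteq> euc n"
    using zs(2) by (auto simp: C_def badU_def badF_def grid_def euc_def)
  moreover have "(\<Pi>\<^sub>E i\<in>{..<n}. {0..<real L}) \<subseteq> (\<Union>c\<in>C. euc_cball n 1 c)"
  proof
    fix x assume x: "x \<in> (\<Pi>\<^sub>E i\<in>{..<n}. {0..<real L})"
    then have xe: "x \<in> euc n" by (auto simp: euc_def)
    define y where "y = corner n m' x"
    define u where "u = corner n m y"
    have y: "y \<in> grid n m' L" unfolding y_def using m x by (intro corner_in_grid)
    have u: "u \<in> grid n m L" unfolding u_def using m y by (intro corner_in_grid cube)
    have xy: "euc_dist n x y \<le> \<epsilon>" unfolding y_def \<epsilon>_def using m x by (intro euc_dist_corner_le)
    have yu: "euc_dist n y u \<le> \<rho>" unfolding u_def \<rho>_def by (rule euc_dist_corner_le[OF m(1) cube[OF y m(2)]])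
    have "\<exists>c\<in>C. euc_dist n x c \<le> 1"
    proof (cases "u \<in> badU")
      case True
      have "euc_dist n x u \<le> 1"
        using euc_dist_triangle[where n = n and x = x and y = y and z = u] xy yu \<rho>\<epsilon> by linarith
      then show ?thesis using True by (auto simp: C_def)
    next
      case False
      then have hu: "hits (A u) \<ge> k" using u by (auto simp: badU_def)
      show ?thesis
      proof (cases "\<exists>z\<in>set zs. euc_dist n y z \<le> 1 - \<epsilon>")
        case True
        then obtain z where z: "z \<in> set zs" "euc_dist n y z \<le> 1 - \<epsilon>" by auto
        then have "euc_dist n x z \<le> 1"
          using euc_dist_triangle[where n = n and x = x and y = y and z = z] xy by linarith
        then show ?thesis using z by (auto simp: C_def)
      next
        case far: False
        \<comment> \<open>No centre is near \<open>y\<close>, so every one of the many hits of \<open>A u\<close> lies in the cap of \<open>y\<close>.\<close>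
        have "filter (\<lambda>z. z \<in> A u) zs = filter (\<lambda>z. z \<in> B y) zs"
        proof (rule filter_cong[OF refl])
          fix z assume "z \<in> set zs"
          then have "z \<notin> euc_cball n (1 - \<epsilon>) y"
            using far euc_dist_commute[where n = n and x = y and y = z] by (auto simp: euc_cball_def)
          then show "z \<in> A u \<longleftrightarrow> z \<in> B y" by (simp add: B_def u_def)
        qed
        then have "y \<in> badF" using hu y by (simp add: badF_def hits_def)
        moreover have "euc_dist n x y \<le> 1" using xy \<epsilon> s by linarith
        ultimately show ?thesis by (auto simp: C_def)
      qed
    qed
    then show "x \<in> (\<Union>c\<in>C. euc_cball n 1 c)" using xe by (auto simp: euc_cball_def)
  qed
  ultimately show ?thesis using bad by (intro exI[of _ C]) auto
qed

text \<open>
  Taking the number of centres so that \<open>D \<le> d \<le> D + 1\<close>. Multiplying the number of grid points by the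
  volume of the unit ball and dividing by \<open>L\<^sup>n\<close> leaves \<open>m\<^sup>n\<close> times the volume of the ball, independent
  of \<open>L\<close>; and \<open>(1 + 2/L)\<^sup>n\<close> is the cost of the enlarged cube.
\<close>

lemma min_covering_density_le_parameters:
  fixes n L m m' k :: nat and s \<theta> D T :: real
  defines "\<delta> \<equiv> exp (- (s\<^sup>2 * (real m)\<^sup>2 / (8 * real n))) ^ n"
  assumes n: "n > 0" and m: "m > 0" "m' > 0" and s: "0 < s" "s \<le> 1/5"
    and fine: "sqrt (real n) / real m' \<le> s / 4" and coarse: "real n / (real m)\<^sup>2 \<le> s / 4"
    and \<theta>: "0 < \<theta>" "\<theta> \<le> 1" and L: "L > 0" and v1: "ball_vol n \<le> 1"
    and D: "D \<ge> 0" "T \<le> (1 - \<theta>) * (1 - s) ^ n * D"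
  shows "min_covering_density n \<le> ennreal ((D + 1) * (1 + 2 / real L) ^ n
    + ball_vol n * real m ^ n * (1 / \<theta>) ^ k * exp (- T)
    + ball_vol n * real m' ^ n * \<delta> ^ k * exp (D + 1))"
proof -
  define v where "v = ball_vol n"
  define V where "V = (real L + 2) ^ n"
  have v: "0 < v" "v \<le> 1" using ball_vol_pos[OF n] v1 by (simp_all add: v_def)
  have V: "V \<ge> 1" unfolding V_def by (rule one_le_power) simp
  define N where "N = nat \<lceil>D * V / v\<rceil>"
  define d where "d = real N * v / V"
  have N: "D * V / v \<le> real N" "real N \<le> D * V / v + 1"
  proof -
    have "0 \<le> D * V / v" using D v V by simp
    then show "D * V / v \<le> real N" "real N \<le> D * V / v + 1"
      unfolding N_def by linarith+
  qed
  have d1: "D \<le> d" using N(1) v V by (simp add: d_def field_simps)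
  have d2: "d \<le> D + 1"
  proof -
    have "real N * v \<le> D * V + v" using N(2) v by (simp add: field_simps)
    also have "\<dots> \<le> (D + 1) * V" using v V by (simp add: algebra_simps)
    finally show ?thesis using V by (simp add: d_def field_simps)
  qed
  have \<delta>: "\<delta> > 0" by (simp add: \<delta>_def)
  obtain C where C: "finite C" "C \<subseteq> euc n" "(\<Pi>\<^sub>E i\<in>{..<n}. {0..<real L}) \<subseteq> (\<Union>c\<in>C. euc_cball n 1 c)"
    and card: "real (card C) \<le> real N
      + real ((m * L) ^ n) * ((1 / \<theta>) ^ k * exp (- (1 - \<theta>) * (1 - s) ^ n * d))
      + real ((m' * L) ^ n) * (\<delta> ^ k * exp d)"
    using covering_of_cube[OF n m s fine coarse \<theta>, of L N k] unfolding d_def v_def V_def \<delta>_def by blast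
  have "min_covering_density n \<le> ennreal (real (card C) * v / real L ^ n)"
    unfolding v_def using C L by (intro min_covering_density_le_cube n) auto
  also have "\<dots> \<le> ennreal ((D + 1) * (1 + 2 / real L) ^ n
    + v * real m ^ n * (1 / \<theta>) ^ k * exp (- T) + v * real m' ^ n * \<delta> ^ k * exp (D + 1))"
  proof (rule ennreal_leI)
    have "real (card C) * v / real L ^ n \<le> (real N
      + real ((m * L) ^ n) * ((1 / \<theta>) ^ k * exp (- (1 - \<theta>) * (1 - s) ^ n * d))
      + real ((m' * L) ^ n) * (\<delta> ^ k * exp d)) * v / real L ^ n"
      using v by (intro divide_right_mono mult_right_mono card) auto
    also have "\<dots> = d * (1 + 2 / real L) ^ n
      + v * real m ^ n * (1 / \<theta>) ^ k * exp (- (1 - \<theta>) * (1 - s) ^ n * d)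
      + v * real m' ^ n * \<delta> ^ k * exp d"
    proof -
      have "1 + 2 / real L = (real L + 2) / real L" using L by (simp add: field_simps)
      then have "real N * v / real L ^ n = d * (1 + 2 / real L) ^ n"
        using V by (simp add: d_def V_def power_divide)
      then show ?thesis using L by (simp add: add_divide_distrib ring_distribs power_mult_distrib)
    qed
    also have "\<dots> \<le> (D + 1) * (1 + 2 / real L) ^ n
      + v * real m ^ n * (1 / \<theta>) ^ k * exp (- T) + v * real m' ^ n * \<delta> ^ k * exp (D + 1)"
    proof -
      have "(1 - \<theta>) * (1 - s) ^ n * D \<le> (1 - \<theta>) * (1 - s) ^ n * d"
        using \<theta> s by (intro mult_left_mono d1) auto
      then have "- (1 - \<theta>) * (1 - s) ^ n * d \<le> - T"
        using D(2) by (simp only: mult_minus_left neg_le_iff_le)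
      then show ?thesis
        using v \<theta> \<delta> d2 by (intro add_mono mult_mono mult_left_mono mult_right_mono) auto
    qed
    finally show "real (card C) * v / real L ^ n \<le> (D + 1) * (1 + 2 / real L) ^ n
      + v * real m ^ n * (1 / \<theta>) ^ k * exp (- T) + v * real m' ^ n * \<delta> ^ k * exp (D + 1)" .
  qed
  finally show ?thesis unfolding v_def .
qed

section \<open>Asymptotics\<close>

definition log_ball_bound :: "real \<Rightarrow> real" where
  "log_ball_bound x = x * ln (sqrt (2 * pi) * exp (1/2) / sqrt x)"

lemma ball_vol_le_exp:
  assumes "n > 0"
  shows "ball_vol n \<le> exp (log_ball_bound (real n))"
proof -
  define b where "b = sqrt (2 * pi) * exp (1/2) / sqrt (real n)"
  have "b > 0" using assms unfolding b_def by (intro divide_pos_pos mult_pos_pos) auto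
  then have "exp (log_ball_bound (real n)) = b ^ n"
    by (simp add: log_ball_bound_def b_def[symmetric] exp_of_nat_mult)
  then show ?thesis using ball_vol_le[OF assms] by (simp add: b_def)
qed

text \<open>
  The exponent \<open>T\<close> for which \<open>e\<^sup>-\<^sup>T\<close> outweighs the number of coarse grid points: the leading term
  comes from mesh \<open>1/\<surd>n\<close>, the second one pays for the logarithmic factors in the mesh and, with room
  to spare, for the terms of order \<open>n\<close>.
\<close>

definition required_hits :: "real \<Rightarrow> real" where
  "required_hits x = x * ln x / 2 + 4 * x * ln (ln x)"

text \<open>
  The density of random balls that yields \<^const>\<open>required_hits\<close> after the losses \<open>1 - \<theta>\<close> with \<open>\<theta> = 1/x\<close>
  and \<open>(1 - s)\<^sup>x \<ge> 1 - 1 / ln x\<close> with \<open>s = 1 / (x ln x)\<close>.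
\<close>

definition mean_multiplicity :: "real \<Rightarrow> real" where
  "mean_multiplicity x = required_hits x / ((1 - 1 / x) * (1 - 1 / ln x))"

text \<open>
  Write \<open>l = ln n\<close>. The choices are \<open>s = 1/(n l)\<close>, coarse side \<open>1/m \<approx> 1/(n l\<^sup>3)\<close>, fine side \<open>1/n\<^sup>3\<close>,
  \<open>k \<approx> n/l\<close>, \<open>\<theta> = 1/n\<close> and \<open>L = n\<^sup>2\<close>. They give \<open>\<delta> \<le> e\<^bsup>- l^4 / 8\<^esup>\<close>, hence \<open>\<delta>\<^sup>k \<le> e\<^bsup>- n l^3 / 8\<^esup>\<close>,
  against which the \<open>e\<^bsup>O(n l)\<^esup>\<close> fine points do not count, while \<open>\<theta>\<^bsup>-k\<^esup> \<approx> e\<^sup>n\<close> remains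
  negligible. Each kind of bad point then adds at most \<open>1\<close> to the density.
\<close>

lemma min_covering_density_le_mean_multiplicity:
  "\<forall>\<^sub>F n in sequentially.
    min_covering_density n \<le> ennreal ((mean_multiplicity (real n) + 1) * exp (2 / real n) + 2)"
proof -
  have "\<forall>\<^sub>F n::nat in sequentially. log_ball_bound (real n) + real n * ln (real n * ln n ^ 3 + 1)
      + (real n / ln n + 1) * ln n \<le> required_hits (real n)"
    unfolding log_ball_bound_def required_hits_def by real_asymp
  moreover have "\<forall>\<^sub>F n::nat in sequentially. log_ball_bound (real n) + 3 * real n * ln n
      + (mean_multiplicity (real n) + 1) \<le> real n / ln n * (ln n ^ 4 / 8)"
    unfolding log_ball_bound_def required_hits_def mean_multiplicity_def by real_asymp
  moreover have "\<forall>\<^sub>F n::nat in sequentially. log_ball_bound (real n) \<le> 0"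
    unfolding log_ball_bound_def by real_asymp
  moreover have "\<forall>\<^sub>F n::nat in sequentially. 0 \<le> required_hits (real n)"
    unfolding required_hits_def by real_asymp
  moreover have "\<forall>\<^sub>F n::nat in sequentially. 1 / (real n * ln n) \<le> 1/5" by real_asymp
  moreover have "\<forall>\<^sub>F n::nat in sequentially. sqrt (real n) / real n ^ 3 \<le> 1 / (real n * ln n) / 4"
    by real_asymp
  moreover have "\<forall>\<^sub>F n::nat in sequentially. real n / (real n * ln n ^ 3)\<^sup>2 \<le> 1 / (real n * ln n) / 4"
    by real_asymp
  moreover have "\<forall>\<^sub>F n::nat in sequentially. 1 < ln (real n)" by real_asymp
  moreover have "\<forall>\<^sub>F n::nat in sequentially. n > 1" by (rule eventually_gt_at_top)
  ultimately show ?thesis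
  proof eventually_elim
    case (elim n)
    define l where "l = ln (real n)"
    define G where "G = log_ball_bound (real n)"
    define D where "D = mean_multiplicity (real n)"
    define T where "T = required_hits (real n)"
    define s where "s = 1 / (real n * l)"
    define m where "m = nat \<lceil>real n * l ^ 3\<rceil>"
    define k where "k = nat \<lceil>real n / l\<rceil>"
    define \<delta> where "\<delta> = exp (- (s\<^sup>2 * (real m)\<^sup>2 / (8 * real n))) ^ n"
    note defs = l_def[symmetric] G_def[symmetric] D_def[symmetric] T_def[symmetric]
    have n: "n > 1" and l: "l > 1" and s5: "s \<le> 1/5" and G0: "G \<le> 0" and T0: "T \<ge> 0"
      and coarse_bad: "G + real n * ln (real n * l ^ 3 + 1) + (real n / l + 1) * l \<le> T"
      and fine_bad: "G + 3 * real n * l + (D + 1) \<le> real n / l * (l ^ 4 / 8)"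
      and fine: "sqrt (real n) / real n ^ 3 \<le> s / 4"
      and coarse: "real n / (real n * l ^ 3)\<^sup>2 \<le> s / 4"
      using elim unfolding defs s_def by simp_all
    have nl: "real n * l ^ 3 > 0" "real n / l > 0" using n l by simp_all
    have m: "real n * l ^ 3 \<le> real m" "real m \<le> real n * l ^ 3 + 1" "m > 0"
      using nl(1) unfolding m_def by linarith+
    have k: "real n / l \<le> real k" "real k \<le> real n / l + 1"
      using nl(2) unfolding k_def by linarith+
    have s: "s > 0" using n l by (simp add: s_def)
    have v: "ball_vol n \<le> exp G" "0 < ball_vol n"
      using n ball_vol_le_exp[of n] ball_vol_pos[of n] by (simp_all add: G_def)
    have expl: "exp l = real n" using n by (simp add: l_def)
    have "real n / (real m)\<^sup>2 \<le> real n / (real n * l ^ 3)\<^sup>2"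
      using n l nl m by (intro divide_left_mono power_mono mult_pos_pos zero_less_power) auto
    with coarse have coarse': "real n / (real m)\<^sup>2 \<le> s / 4" by linarith
    have fac: "0 < 1 - 1 / real n" "0 < 1 - 1 / l" using n l by simp_all
    have Deq: "(1 - 1 / real n) * (1 - 1 / l) * D = T"
      using n l fac unfolding D_def mean_multiplicity_def defs by simp
    have D0: "D \<ge> 0" using fac T0 unfolding D_def mean_multiplicity_def defs by simp
    have "1 - 1 / l \<le> (1 - s) ^ n"
      using Bernoulli_inequality[of "- s" n] s5 n by (simp add: s_def)
    then have T: "T \<le> (1 - 1 / real n) * (1 - s) ^ n * D"
      using fac D0 unfolding Deq[symmetric] by (intro mult_right_mono mult_left_mono) auto
    have "min_covering_density n \<le> ennreal ((D + 1) * (1 + 2 / real (n ^ 2)) ^ n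
      + ball_vol n * real m ^ n * (1 / (1 / real n)) ^ k * exp (- T)
      + ball_vol n * real (n ^ 3) ^ n * \<delta> ^ k * exp (D + 1))"
      unfolding \<delta>_def
      using n m s s5 fine coarse' v G0 D0 T
      by (intro min_covering_density_le_parameters) (auto intro: order_trans[of _ "exp G"])
    also have "\<dots> \<le> ennreal ((D + 1) * exp (2 / real n) + 1 + 1)"
    proof (intro ennreal_leI add_mono)
      have "(1 + 2 / real (n ^ 2)) ^ n \<le> exp (2 / real (n ^ 2)) ^ n"
        by (intro power_mono exp_ge_add_one_self) simp
      also have "\<dots> = exp (2 / real n)"
        using n by (simp add: power2_eq_square flip: exp_of_nat_mult)
      finally show "(D + 1) * (1 + 2 / real (n ^ 2)) ^ n \<le> (D + 1) * exp (2 / real n)"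
        using D0 by (intro mult_left_mono) auto
      have "real m ^ n \<le> (real n * l ^ 3 + 1) ^ n" using m by (intro power_mono) auto
      also have "\<dots> = exp (real n * ln (real n * l ^ 3 + 1))"
        using nl by (simp add: exp_of_nat_mult)
      finally have m_pow: "real m ^ n \<le> exp (real n * ln (real n * l ^ 3 + 1))" .
      have "(1 / (1 / real n)) ^ k = exp (real k * l)" by (simp add: exp_of_nat_mult expl)
      also have "\<dots> \<le> exp ((real n / l + 1) * l)" using k l by simp
      finally have "ball_vol n * real m ^ n * (1 / (1 / real n)) ^ k * exp (- T)
        \<le> exp G * exp (real n * ln (real n * l ^ 3 + 1)) * exp ((real n / l + 1) * l) * exp (- T)"
        using v m_pow by (intro mult_right_mono mult_mono) auto
      also have "\<dots> \<le> 1" using coarse_bad by (simp flip: exp_add)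
      finally show "ball_vol n * real m ^ n * (1 / (1 / real n)) ^ k * exp (- T) \<le> 1" .
      have n3: "real (n ^ 3) ^ n = exp (3 * real n * l)"
        by (simp add: expl[symmetric] mult_ac flip: exp_of_nat_mult)
      have "l\<^sup>2 = s * (real n * l ^ 3)" using n l by (simp add: s_def power2_eq_square power3_eq_cube)
      also have "\<dots> \<le> s * real m" using s m by (intro mult_left_mono) auto
      finally have "(l\<^sup>2)\<^sup>2 \<le> (s * real m)\<^sup>2" by (intro power_mono) auto
      then have "l ^ 4 \<le> s\<^sup>2 * (real m)\<^sup>2" by (simp add: power_mult_distrib flip: power_mult)
      then have "\<delta> \<le> exp (- (l ^ 4 / 8))"
        using n by (simp add: \<delta>_def flip: exp_of_nat_mult)
      then have "\<delta> ^ k \<le> exp (- (l ^ 4 / 8)) ^ k" by (intro power_mono) (simp_all add: \<delta>_def)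
      also have "\<dots> = exp (- (real k * (l ^ 4 / 8)))" by (simp flip: exp_of_nat_mult)
      also have "\<dots> \<le> exp (- (real n / l * (l ^ 4 / 8)))"
        using k l by (simp only: exp_le_cancel_iff neg_le_iff_le) (intro mult_right_mono, auto)
      finally have "ball_vol n * real (n ^ 3) ^ n * \<delta> ^ k * exp (D + 1)
        \<le> exp G * exp (3 * real n * l) * exp (- (real n / l * (l ^ 4 / 8))) * exp (D + 1)"
        using v n3 by (intro mult_right_mono mult_mono) (auto simp: \<delta>_def)
      also have "\<dots> \<le> 1" using fine_bad by (simp flip: exp_add)
      finally show "ball_vol n * real (n ^ 3) ^ n * \<delta> ^ k * exp (D + 1) \<le> 1" .
    qed
    finally show ?case by (simp only: D_def add.assoc one_add_one)
  qed
qed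

theorem corollary2:
  shows "\<exists>\<eta> :: nat \<Rightarrow> real. \<eta> \<longlonglongrightarrow> 0 \<and>
    (\<forall>\<^sub>F n in sequentially.
       min_covering_density n \<le> ennreal ((1/2 + \<eta> n) * real n * ln (real n)))"
proof (intro exI conjI)
  define \<eta> where "\<eta> n = ((mean_multiplicity (real n) + 1) * exp (2 / real n) + 2) / (real n * ln (real n)) - 1/2"
    for n :: nat
  show "\<eta> \<longlonglongrightarrow> 0" unfolding \<eta>_def mean_multiplicity_def required_hits_def by real_asymp
  show "\<forall>\<^sub>F n in sequentially.
       min_covering_density n \<le> ennreal ((1/2 + \<eta> n) * real n * ln (real n))"
    using min_covering_density_le_mean_multiplicity eventually_gt_at_top[of 1]
  proof eventually_elim
    case (elim n)
    then have "(1/2 + \<eta> n) * real n * ln (real n) = (mean_multiplicity (real n) + 1) * exp (2 / real n) + 2"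
      by (simp add: \<eta>_def)
    with elim show ?case by simp
  qed
qed

end
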